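(* Let $a$, $b$, $c$ be integers and let $x_1,y_1,x_2,y_2,x_3,y_3 \in \mathbb{Q}$. Then $$\left[a x_1^2 + b x_1 y_1 + c y_1^2\right]\left[a x_2^2 + b x_2 y_2 + c y_2^2\right] = u^2 + b\,u v + a c\,v^2,$$ where $u = a x_1 x_2 + b x_1 y_2 + c y_1 y_2$ and $v = y_1 x_2 - x_1 y_2$. Moreover, $$\left[a x_1^2 + b x_1 y_1 + c y_1^2\right]\left[a x_2^2 + b x_2 y_2 + c y_2^2\right]\left[a x_3^2 + b x_3 y_3 + c y_3^2\right] = a x^2 + b x y + c y^2,$$ where $$x = a\,(x_1 x_2 x_3) + b\,(x_1 y_2 x_3) + c\,(x_1 y_2 y_3 - y_1 x_2 y_3 + y_1 y_2 x_3),$$ $$y = a\,(x_1 x_2 y_3 - x_1 y_2 x_3 + y_1 x_2 x_3) + b\,(y_1 x_2 y_3) + c\,(y_1 y_2 y_3).$$ *)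

theory Defs
  imports Complex_Main
begin

end

theory Submission
  imports Defs
begin

text \<open>Let \<theta>, \<theta>' be the roots of t^2 + b t + ac and N the norm, so N(u -
  v\<theta>) = u^2 + buv + ac v^2 and a f(x,y) = N(ax - y\<theta>) for the form f. Then (a x1 -
  y1\<theta>)(a x2 - y2\<theta>') = a(u - v\<theta>), and (u - v\<theta>)(a x3 - y3\<theta>) = ax -
  y\<theta>. Take norms and cancel powers of a, an indeterminate.\<close>

theorem proposition4p1:
  fixes a b c :: int
    and x1 y1 x2 y2 x3 y3 :: rat
  shows
    "(let u = of_int a * x1 * x2 + of_int b * x1 * y2 + of_int c * y1 * y2;
          v = y1 * x2 - x1 * y2
      in (of_int a * x1^2 + of_int b * x1 * y1 + of_int c * y1^2)
           * (of_int a * x2^2 + of_int b * x2 * y2 + of_int c * y2^2)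
         = u^2 + of_int b * u * v + of_int a * of_int c * v^2)
     \<and>
     (let x = of_int a * (x1 * x2 * x3) + of_int b * (x1 * y2 * x3)
              + of_int c * (x1 * y2 * y3 - y1 * x2 * y3 + y1 * y2 * x3);
          y = of_int a * (x1 * x2 * y3 - x1 * y2 * x3 + y1 * x2 * x3)
              + of_int b * (y1 * x2 * y3) + of_int c * (y1 * y2 * y3)
      in (of_int a * x1^2 + of_int b * x1 * y1 + of_int c * y1^2)
           * (of_int a * x2^2 + of_int b * x2 * y2 + of_int c * y2^2)
           * (of_int a * x3^2 + of_int b * x3 * y3 + of_int c * y3^2)
         = of_int a * x^2 + of_int b * x * y + of_int c * y^2)"
  \<comment> \<open>Both claims are polynomial identities, so expansion settles them, a = 0
    included.\<close>
  unfolding Let_def by (intro conjI; algebra)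

end
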